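(* Let $F_2$ be a finite subset of $\mathbb{Z}^2$ with non-zero row sums $r_1 \geq r_2 \geq \ldots \geq r_m$ and non-zero column sums $c_1 \geq c_2 \geq \ldots \geq c_n$ (so that $F_2 \subseteq \{1,\ldots,m\}\times\{1,\ldots,n\}$, where $r_i$ is the row sum of row $i$ and $c_j$ is the column sum of column $j$). Put $a_j = \#\{i : r_i \geq j \}$ for $1 \leq j \leq n$, and $b_i = \#\{j : c_j \geq i\}$ for $1 \leq i \leq m$. Define $\alpha_0 = \min\{\alpha(F_2, F) : F \text{ is a uniquely determined set}\}$. Let $F_1$ be a uniquely determined set with row sums $u_1 \geq u_2 \geq \ldots$ and column sums $v_1 \geq v_2 \geq \ldots$ (here $u_i$ is the row sum of row $i$ and $v_j$ the column sum of column $j$ for $i,j\ge 1$, and all rows and columns of $F_1$ with index $\leq 0$ are empty). Then the following conditions are equivalent: (i) $\alpha(F_2, F_1) = \alpha_0$; (ii) for all $j \geq 1$: $\min(a_j, c_j) \leq v_j \leq \max(a_j, c_j)$ if $1 \leq j \leq n$, and $v_j = 0$ otherwise; (iii) for all $i \geq 1$: $\min(b_i, r_i) \leq u_i \leq \max(b_i, r_i)$ if $1 \leq i \leq m$, and $u_i = 0$ otherwise.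
   Context: For $F$ a finite subset of $\mathbb{Z}^2$, the row sum of row $i\in\mathbb{Z}$ is the number of $j \in \mathbb{Z}$ with $(i,j)\in F$, and the column sum of column $j\in\mathbb{Z}$ is the number of $i \in \mathbb{Z}$ with $(i,j)\in F$. The row and column sums together are called the line sums of $F$. A finite set $F\subset\mathbb{Z}^2$ is called uniquely determined (by its line sums) if every subset $F'$ of $\mathbb{Z}^2$ with exactly the same row and column sums as $F$ (for every row index and every column index in $\mathbb{Z}$) equals $F$. For finite $F, G\subset \mathbb{Z}^2$ with row sums $r_i^{F}, r_i^{G}$ ($i\in\mathbb{Z}$) and column sums $c_j^{F}, c_j^{G}$ ($j\in\mathbb{Z}$), define $$\alpha(F,G)=\frac12\Big(\sum_{j\in\mathbb{Z}}|c_j^{F}-c_j^{G}|+\sum_{i\in\mathbb{Z}}|r_i^{F}-r_i^{G}|\Big).$$ *)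

theory Defs
  imports Complex_Main "HOL-Library.Groups_Big_Fun"
begin

definition row_sum :: "(int \<times> int) set \<Rightarrow> int \<Rightarrow> nat" where
  "row_sum F i = card {j. (i, j) \<in> F}"

definition col_sum :: "(int \<times> int) set \<Rightarrow> int \<Rightarrow> nat" where
  "col_sum F j = card {i. (i, j) \<in> F}"

text \<open>
  Since \<^const>\<open>card\<close> is 0 on infinite sets, the finiteness conditions on the lines of \<open>F'\<close>
  are what makes the equations say that the number of points on each line is the same;
  \<open>F'\<close> is otherwise an arbitrary subset of the plane.
\<close>

definition uniquely_determined :: "(int \<times> int) set \<Rightarrow> bool" where
  "uniquely_determined F \<longleftrightarrow>
     finite F \<and>
     (\<forall>F'. (\<forall>i. finite {j. (i, j) \<in> F'} \<and> row_sum F' i = row_sum F i) \<and>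
           (\<forall>j. finite {i. (i, j) \<in> F'} \<and> col_sum F' j = col_sum F j) \<longrightarrow> F' = F)"

text \<open>
  \<^const>\<open>Sum_any\<close> sums over all integers; for finite \<open>F\<close> and \<open>G\<close> only finitely many summands
  are nonzero.
\<close>

definition alpha :: "(int \<times> int) set \<Rightarrow> (int \<times> int) set \<Rightarrow> real" where
  "alpha F G =
     1 / 2 * (Sum_any (\<lambda>j. \<bar>real (col_sum F j) - real (col_sum G j)\<bar>)
            + Sum_any (\<lambda>i. \<bar>real (row_sum F i) - real (row_sum G i)\<bar>))"

definition alpha0 :: "(int \<times> int) set \<Rightarrow> real" where
  "alpha0 F\<^sub>2 = (LEAST x. x \<in> {alpha F\<^sub>2 F | F. uniquely_determined F})"

end

theory Submission
  imports Defs
begin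

text \<open>
  Let \<open>X\<close> be the Young diagram with row lengths \<open>r\<close> (column lengths \<open>a\<close>) and \<open>Y\<close> the one with
  column lengths \<open>c\<close> (row lengths \<open>b\<close>). A set is uniquely determined only if its rows are
  nested, and then its row sums and column sums, once sorted, belong to one Young diagram \<open>D\<close>.
  Counting cells, and using that sorting does not increase \<open>\<ell>\<^sup>1\<close>-distances,
  \<open>2 \<alpha>(F\<^sub>2, F) \<ge> |X \<triangle> D| + |Y \<triangle> D| \<ge> |X \<triangle> Y|\<close>. The first inequality is an equality
  if the line sums of \<open>F\<close> are already sorted, the second one iff
  \<open>X \<inter> Y \<subseteq> D \<subseteq> X \<union> Y\<close>, and \<open>D = X\<close> attains the bound. Reading the inclusions column by column
  gives (ii), row by row (iii).
\<close>

text \<open>For \<open>f\<close> of finite support, the Young diagram whose row lengths are the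
  nonzero values of \<open>f\<close> in decreasing order. Counting superlevel sets gives its columns
  directly, with no sorting permutation to choose.\<close>

definition diagram :: "(int \<Rightarrow> nat) \<Rightarrow> (nat \<times> nat) set" where
  "diagram f = {(k, l). 1 \<le> k \<and> 1 \<le> l \<and> k \<le> card {i. l \<le> f i}}"

text \<open>Sorted line sums indexed by all integers: the nonzero values start at index 1, so
  monotonicity is required only from there on.\<close>

definition decreasing :: "(int \<Rightarrow> nat) \<Rightarrow> bool" where
  "decreasing f \<longleftrightarrow> (\<forall>i\<le>0. f i = 0) \<and> antimono_on {1..} f"

subsection \<open>Line sums and their diagrams\<close>

lemma finite_superlevel:
  fixes f :: "int \<Rightarrow> nat"
  assumes "finite {i. f i \<noteq> 0}" and "1 \<le> l"
  shows "finite {i. l \<le> f i}"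
  by (rule finite_subset[OF _ assms(1)]) (use assms(2) in auto)

text \<open>A superlevel set at a positive level is an initial segment of the positive integers, so
  its size tells which indices it contains.\<close>

lemma decreasing_card_le_iff:
  assumes fin: "finite {i. f i \<noteq> 0}" and dec: "decreasing f" and k: "1 \<le> k" and l: "1 \<le> l"
  shows "k \<le> card {i. l \<le> f i} \<longleftrightarrow> l \<le> f (int k)"
proof
  assume le: "l \<le> f (int k)"
  have "{1..int k} \<subseteq> {i. l \<le> f i}"
  proof
    fix i assume "i \<in> {1..int k}"
    then have "f (int k) \<le> f i"
      using dec by (auto simp: decreasing_def monotone_on_def)
    then show "i \<in> {i. l \<le> f i}" using le by simp
  qed
  from card_mono[OF finite_superlevel[OF fin l] this] show "k \<le> card {i. l \<le> f i}" by simp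
next
  assume card: "k \<le> card {i. l \<le> f i}"
  show "l \<le> f (int k)"
  proof (rule ccontr)
    assume less: "\<not> l \<le> f (int k)"
    have "{i. l \<le> f i} \<subseteq> {1..int k - 1}"
    proof
      fix i assume "i \<in> {i. l \<le> f i}"
      then have i: "l \<le> f i" by simp
      have "1 \<le> i"
      proof (rule ccontr)
        assume "\<not> 1 \<le> i"
        then have "f i = 0" using dec by (simp add: decreasing_def)
        then show False using i l by simp
      qed
      moreover have "i < int k"
      proof (rule ccontr)
        assume "\<not> i < int k"
        then have "f i \<le> f (int k)"
          using dec k by (auto simp: decreasing_def monotone_on_def)
        then show False using i less by simp
      qed
      ultimately show "i \<in> {1..int k - 1}" by simp
    qed
    from card_mono[OF _ this] have "card {i. l \<le> f i} \<le> k - 1" by simp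
    then show False using card k by linarith
  qed
qed

lemma mem_diagram_decreasing_iff:
  assumes "finite {i. f i \<noteq> 0}" and "decreasing f"
  shows "(k, l) \<in> diagram f \<longleftrightarrow> 1 \<le> k \<and> 1 \<le> l \<and> l \<le> f (int k)"
  using decreasing_card_le_iff[OF assms] by (auto simp: diagram_def)

lemma finite_diagram:
  assumes fin: "finite {i. f i \<noteq> 0}"
  shows "finite (diagram f)"
proof -
  have "diagram f \<subseteq> {..card {i. f i \<noteq> 0}} \<times> {..Max (f ` {i. f i \<noteq> 0})}"
  proof
    fix p assume "p \<in> diagram f"
    then obtain k l where p: "p = (k, l)" and kl: "1 \<le> k" "1 \<le> l" "k \<le> card {i. l \<le> f i}"
      by (auto simp: diagram_def)
    have "card {i. l \<le> f i} \<le> card {i. f i \<noteq> 0}"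
      by (rule card_mono[OF fin]) (use kl in auto)
    moreover have "{i. l \<le> f i} \<noteq> {}" using kl by (metis card.empty le_trans not_one_le_zero)
    then obtain i where "l \<le> f i" by blast
    then have "l \<le> Max (f ` {i. f i \<noteq> 0})"
      using fin kl by (intro Max_ge_iff[THEN iffD2]) (auto intro!: exI[of _ i])
    ultimately show "p \<in> {..card {i. f i \<noteq> 0}} \<times> {..Max (f ` {i. f i \<noteq> 0})}"
      using p kl by simp
  qed
  then show ?thesis by (rule finite_subset) simp
qed

section \<open>Distances as numbers of cells\<close>

lemma card_threshold_differ:
  fixes x y :: nat
  shows "int (card {l. 1 \<le> l \<and> (l \<le> x) \<noteq> (l \<le> y)}) = \<bar>int x - int y\<bar>"
proof (cases x y rule: le_cases)
  case le
  then have "{l. 1 \<le> l \<and> (l \<le> x) \<noteq> (l \<le> y)} = {Suc x..y}" by auto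
  then show ?thesis using le by simp
next
  case ge
  then have "{l. 1 \<le> l \<and> (l \<le> x) \<noteq> (l \<le> y)} = {Suc y..x}" by auto
  then show ?thesis using ge by simp
qed

lemma finite_threshold_differ:
  fixes x y :: nat
  shows "finite {l. 1 \<le> l \<and> (l \<le> x) \<noteq> (l \<le> y)}"
  by (rule finite_subset[of _ "{..x + y}"]) auto

lemma threshold_differ_eq_Sigma:
  fixes f g :: "int \<Rightarrow> nat"
  shows "{(i, l). 1 \<le> l \<and> (l \<le> f i) \<noteq> (l \<le> g i)} =
    Sigma ({i. f i \<noteq> 0} \<union> {i. g i \<noteq> 0}) (\<lambda>i. {l. 1 \<le> l \<and> (l \<le> f i) \<noteq> (l \<le> g i)})"
  by auto

text \<open>At each index, \<open>card_threshold_differ\<close> turns the absolute difference into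
  the number of thresholds separating the two values; the l1-distance becomes the number of cells
  between two graphs.\<close>

lemma Sum_any_abs_diff:
  fixes f g :: "int \<Rightarrow> nat"
  assumes "finite {i. f i \<noteq> 0}" and "finite {i. g i \<noteq> 0}"
  shows "Sum_any (\<lambda>i. \<bar>real (f i) - real (g i)\<bar>) =
    real (card {(i, l). 1 \<le> l \<and> (l \<le> f i) \<noteq> (l \<le> g i)})"
proof -
  let ?I = "{i. f i \<noteq> 0} \<union> {i. g i \<noteq> 0}"
  have fin: "finite ?I" using assms by simp
  have "Sum_any (\<lambda>i. \<bar>real (f i) - real (g i)\<bar>) = (\<Sum>i\<in>?I. \<bar>real (f i) - real (g i)\<bar>)"
    by (rule Sum_any.expand_superset[OF fin]) auto
  also have "\<dots> = (\<Sum>i\<in>?I. real (card {l. 1 \<le> l \<and> (l \<le> f i) \<noteq> (l \<le> g i)}))"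
  proof (rule sum.cong[OF refl])
    fix i
    show "\<bar>real (f i) - real (g i)\<bar> = real (card {l. 1 \<le> l \<and> (l \<le> f i) \<noteq> (l \<le> g i)})"
      using arg_cong[OF card_threshold_differ[of "f i" "g i"], of real_of_int] by simp
  qed
  also have "\<dots> = real (card {(i, l). 1 \<le> l \<and> (l \<le> f i) \<noteq> (l \<le> g i)})"
    unfolding threshold_differ_eq_Sigma
    by (subst card_SigmaI[OF fin]) (use finite_threshold_differ in auto)
  finally show ?thesis .
qed

lemma abs_card_diff_le:
  assumes "finite A" and "finite B"
  shows "\<bar>int (card A) - int (card B)\<bar> \<le> int (card {x. (x \<in> A) \<noteq> (x \<in> B)})"
proof -
  have eq: "{x. (x \<in> A) \<noteq> (x \<in> B)} = (A - B) \<union> (B - A)" by auto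
  have "card {x. (x \<in> A) \<noteq> (x \<in> B)} = card (A - B) + card (B - A)"
    unfolding eq by (rule card_Un_disjoint) (use assms in auto)
  moreover have "card A = card (A - B) + card (A \<inter> B)"
    using card_Int_Diff[OF assms(1), of B] by simp
  moreover have "card B = card (B - A) + card (A \<inter> B)"
    using card_Int_Diff[OF assms(2), of A] by (simp add: Int_commute)
  ultimately show ?thesis by linarith
qed

text \<open>Both sides are counted level by level: level \<open>l\<close> contributes the difference of two
  cardinalities on the left and the size of a symmetric difference on the right.\<close>

lemma card_diagram_differ_le:
  fixes f g :: "int \<Rightarrow> nat"
  assumes f: "finite {i. f i \<noteq> 0}" and g: "finite {i. g i \<noteq> 0}"
  shows "card {p. (p \<in> diagram f) \<noteq> (p \<in> diagram g)}
    \<le> card {(i, l). 1 \<le> l \<and> (l \<le> f i) \<noteq> (l \<le> g i)}"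
proof -
  let ?a = "\<lambda>l. card {i. l \<le> f i}" and ?b = "\<lambda>l. card {i. l \<le> g i}"
  let ?T = "{(i, l). 1 \<le> l \<and> (l \<le> f i) \<noteq> (l \<le> g i)}"
  have finT: "finite ?T"
    unfolding threshold_differ_eq_Sigma
    using f g finite_threshold_differ by (intro finite_SigmaI) auto
  let ?P = "{p. (p \<in> diagram f) \<noteq> (p \<in> diagram g)}"
  have "?P \<subseteq> diagram f \<union> diagram g" by auto
  then have finP: "finite ?P"
    by (rule finite_subset) (use finite_diagram f g in simp)
  \<comment> \<open>\<open>L\<close> collects the levels that occur on either side, so that both
    cardinalities become sums over one finite index set.\<close>
  define L where "L = snd ` ?P \<union> snd ` ?T"
  have finL: "finite L" using finP finT by (simp add: L_def)
  have L1: "1 \<le> l" if "l \<in> L" for l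
    using that by (auto simp: L_def diagram_def)
  have P: "?P = prod.swap ` Sigma L (\<lambda>l. {k. 1 \<le> k \<and> (k \<le> ?a l) \<noteq> (k \<le> ?b l)})" (is "_ = _ ` ?P'")
  proof (rule set_eqI, clarify)
    fix k l
    have "(k, l) \<in> prod.swap ` ?P' \<longleftrightarrow> (l, k) \<in> ?P'" by force
    also have "\<dots> \<longleftrightarrow> (k, l) \<in> ?P"
    proof
      assume *: "(l, k) \<in> ?P'"
      then have "1 \<le> l" using L1 by auto
      with * show "(k, l) \<in> ?P" by (auto simp: diagram_def)
    next
      assume *: "(k, l) \<in> ?P"
      then have "l \<in> L" by (force simp: L_def)
      with * show "(l, k) \<in> ?P'" by (auto simp: diagram_def)
    qed
    finally show "(k, l) \<in> ?P \<longleftrightarrow> (k, l) \<in> prod.swap ` ?P'" by simp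
  qed
  have T: "?T = prod.swap ` Sigma L (\<lambda>l. {i. (l \<le> f i) \<noteq> (l \<le> g i)})" (is "_ = _ ` ?T'")
  proof (rule set_eqI, clarify)
    fix i l
    have "(i, l) \<in> prod.swap ` ?T' \<longleftrightarrow> (l, i) \<in> ?T'" by force
    also have "\<dots> \<longleftrightarrow> (i, l) \<in> ?T"
    proof
      assume *: "(l, i) \<in> ?T'"
      then have "1 \<le> l" using L1 by auto
      with * show "(i, l) \<in> ?T" by auto
    next
      assume *: "(i, l) \<in> ?T"
      then have "l \<in> L" unfolding L_def by force
      with * show "(l, i) \<in> ?T'" by auto
    qed
    finally show "(i, l) \<in> ?T \<longleftrightarrow> (i, l) \<in> prod.swap ` ?T'" by simp
  qed
  have finT': "finite {i. (l \<le> f i) \<noteq> (l \<le> g i)}" for l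
    by (rule finite_subset[OF _ finite_UnI[OF f g]]) auto
  have "card ?P = (\<Sum>l\<in>L. card {k. 1 \<le> k \<and> (k \<le> ?a l) \<noteq> (k \<le> ?b l)})"
    unfolding P using finL finite_threshold_differ
    by (subst card_image) (auto intro: inj_onI)
  also have "\<dots> \<le> (\<Sum>l\<in>L. card {i. (l \<le> f i) \<noteq> (l \<le> g i)})"
  proof (rule sum_mono)
    fix l assume "l \<in> L"
    then have l: "1 \<le> l" by (rule L1)
    show "card {k. 1 \<le> k \<and> (k \<le> ?a l) \<noteq> (k \<le> ?b l)} \<le> card {i. (l \<le> f i) \<noteq> (l \<le> g i)}"
      using abs_card_diff_le[OF finite_superlevel[OF f l] finite_superlevel[OF g l]]
        card_threshold_differ[of "?a l" "?b l"] by simp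
  qed
  also have "\<dots> = card ?T"
    unfolding T using finL finT'
    by (subst card_image) (auto intro: inj_onI)
  finally show ?thesis .
qed

text \<open>For sorted functions a diagram is the region under the graph, with natural instead of
  integer row indices. No cell is lost, because both functions vanish at nonpositive
  indices.\<close>

lemma card_diagram_differ_decreasing:
  fixes f g :: "int \<Rightarrow> nat"
  assumes f: "finite {i. f i \<noteq> 0}" "decreasing f" and g: "finite {i. g i \<noteq> 0}" "decreasing g"
  shows "card {p. (p \<in> diagram f) \<noteq> (p \<in> diagram g)}
    = card {(i, l). 1 \<le> l \<and> (l \<le> f i) \<noteq> (l \<le> g i)}"
proof -
  let ?P = "{p. (p \<in> diagram f) \<noteq> (p \<in> diagram g)}"
  let ?T = "{(i, l). 1 \<le> l \<and> (l \<le> f i) \<noteq> (l \<le> g i)}"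
  have "?T = map_prod int id ` ?P"
  proof (rule set_eqI, clarify)
    fix i :: int and l :: nat
    show "(i, l) \<in> ?T \<longleftrightarrow> (i, l) \<in> map_prod int id ` ?P"
    proof
      assume *: "(i, l) \<in> ?T"
      have "1 \<le> i"
      proof (rule ccontr)
        assume "\<not> 1 \<le> i"
        then have "f i = 0" "g i = 0" using f(2) g(2) by (auto simp: decreasing_def)
        then show False using * by auto
      qed
      then obtain k where k: "i = int k" "1 \<le> k"
        by (intro that[of "nat i"]) auto
      then have "(k, l) \<in> ?P"
        using * by (auto simp: mem_diagram_decreasing_iff[OF f] mem_diagram_decreasing_iff[OF g])
      then show "(i, l) \<in> map_prod int id ` ?P" using k by force
    next
      assume "(i, l) \<in> map_prod int id ` ?P"
      then obtain k where "i = int k" "(k, l) \<in> ?P" by auto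
      then show "(i, l) \<in> ?T"
        by (auto simp: mem_diagram_decreasing_iff[OF f] mem_diagram_decreasing_iff[OF g])
    qed
  qed
  moreover have "inj_on (map_prod int (id :: nat \<Rightarrow> nat)) ?P"
    by (rule inj_onI) auto
  ultimately show ?thesis by (simp add: card_image)
qed

lemma card_converse_differ:
  "card {p. (p \<in> A) \<noteq> (p \<in> B)} = card {p. (p \<in> A\<inverse>) \<noteq> (p \<in> B\<inverse>)}"
proof -
  have "{p. (p \<in> A\<inverse>) \<noteq> (p \<in> B\<inverse>)} = {p. (p \<in> A) \<noteq> (p \<in> B)}\<inverse>" by auto
  then show ?thesis by simp
qed

text \<open>A cell in exactly one of \<open>X\<close> and \<open>Y\<close> is counted once on the
  left. A cell on which they agree is counted twice or not at all, and twice exactly when it lies in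
  the last set, the defect in the triangle inequality.\<close>

lemma card_differ_sum:
  assumes "finite X" and "finite Y" and "finite D"
  shows "card {p. (p \<in> Y) \<noteq> (p \<in> D)} + card {p. (p \<in> X) \<noteq> (p \<in> D)} =
    card {p. (p \<in> X) \<noteq> (p \<in> Y)} + 2 * card ((X \<inter> Y - D) \<union> (D - (X \<union> Y)))"
proof -
  let ?Z = "(X \<inter> Y - D) \<union> (D - (X \<union> Y))"
  let ?YD = "{p. (p \<in> Y) \<noteq> (p \<in> D)}" and ?XD = "{p. (p \<in> X) \<noteq> (p \<in> D)}"
    and ?XY = "{p. (p \<in> X) \<noteq> (p \<in> Y)}"
  have sub: "?YD \<subseteq> X \<union> Y \<union> D" "?XD \<subseteq> X \<union> Y \<union> D" "?XY \<subseteq> X \<union> Y \<union> D" by auto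
  have fin: "finite ?YD" "finite ?XD" "finite ?XY" "finite ?Z"
    using assms sub[THEN finite_subset] by auto
  have "card ?YD + card ?XD = card (?YD \<union> ?XD) + card (?YD \<inter> ?XD)"
    using fin by (intro card_Un_Int)
  also have "?YD \<union> ?XD = ?XY \<union> ?Z" by auto
  also have "?YD \<inter> ?XD = ?Z" by auto
  also have "card (?XY \<union> ?Z) = card ?XY + card ?Z"
    using fin by (intro card_Un_disjoint) auto
  finally show ?thesis by simp
qed

section \<open>Line sums of finite sets\<close>

lemma finite_row:
  assumes "finite F"
  shows "finite {j. (i, j) \<in> F}"
  by (rule finite_subset[of _ "snd ` F"]) (use assms in force)+

lemma finite_col:
  assumes "finite F"
  shows "finite {i. (i, j) \<in> F}"
  by (rule finite_subset[of _ "fst ` F"]) (use assms in force)+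

lemma finite_row_support:
  assumes "finite F"
  shows "finite {i. row_sum F i \<noteq> 0}"
proof (rule finite_subset)
  show "{i. row_sum F i \<noteq> 0} \<subseteq> fst ` F"
    by (auto simp: row_sum_def card_eq_0_iff intro: rev_image_eqI)
qed (use assms in simp)

lemma finite_col_support:
  assumes "finite F"
  shows "finite {j. col_sum F j \<noteq> 0}"
proof (rule finite_subset)
  show "{j. col_sum F j \<noteq> 0} \<subseteq> snd ` F"
    by (auto simp: col_sum_def card_eq_0_iff intro: rev_image_eqI)
qed (use assms in simp)

text \<open>Sorting is applied to rows and columns separately. The column diagrams are transposed so
  that they can be compared cell by cell with the row diagrams.\<close>

lemma alpha_ge_card_diagram_differ:
  assumes F: "finite F" and G: "finite G"
  shows "1 / 2 * real (card {p. (p \<in> (diagram (col_sum F))\<inverse>) \<noteq> (p \<in> (diagram (col_sum G))\<inverse>)}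
      + card {p. (p \<in> diagram (row_sum F)) \<noteq> (p \<in> diagram (row_sum G))}) \<le> alpha F G"
proof -
  note col = finite_col_support[OF F] finite_col_support[OF G]
  note row = finite_row_support[OF F] finite_row_support[OF G]
  show ?thesis
    unfolding alpha_def Sum_any_abs_diff[OF col] Sum_any_abs_diff[OF row]
      card_converse_differ[symmetric]
    using card_diagram_differ_le[OF col] card_diagram_differ_le[OF row] by simp
qed

lemma alpha_eq_card_diagram_differ:
  assumes F: "finite F" "decreasing (row_sum F)" "decreasing (col_sum F)"
    and G: "finite G" "decreasing (row_sum G)" "decreasing (col_sum G)"
  shows "alpha F G =
    1 / 2 * real (card {p. (p \<in> (diagram (col_sum F))\<inverse>) \<noteq> (p \<in> (diagram (col_sum G))\<inverse>)}
      + card {p. (p \<in> diagram (row_sum F)) \<noteq> (p \<in> diagram (row_sum G))})"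
proof -
  note col = finite_col_support[OF F(1)] finite_col_support[OF G(1)]
  note row = finite_row_support[OF F(1)] finite_row_support[OF G(1)]
  show ?thesis
    unfolding alpha_def Sum_any_abs_diff[OF col] Sum_any_abs_diff[OF row]
      card_converse_differ[symmetric]
    using card_diagram_differ_decreasing[OF col(1) F(3) col(2) G(3)]
      card_diagram_differ_decreasing[OF row(1) F(2) row(2) G(2)] by simp
qed

subsection \<open>Uniquely determined sets\<close>

text \<open>Otherwise the two given points could be traded for the other corners of their rectangle,
  giving a different set with the same line sums.\<close>

lemma uniquely_determined_no_switch:
  assumes ud: "uniquely_determined F"
    and in1: "(i, j) \<in> F" and in2: "(i', j') \<in> F"
    and out1: "(i, j') \<notin> F"
  shows "(i', j) \<in> F"
proof (rule ccontr)
  assume out2: "(i', j) \<notin> F"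
  have fin: "finite F" using ud by (simp add: uniquely_determined_def)
  have ne: "i \<noteq> i'" "j \<noteq> j'" using in1 in2 out1 out2 by auto
  let ?G = "F - {(i, j), (i', j')} \<union> {(i, j'), (i', j)}"
  have swap: "card (insert y (A - {x})) = card A" if "finite A" "x \<in> A" "y \<notin> A"
    for A :: "int set" and x y
    using that card_Suc_Diff1[of A x] by simp
  have row: "row_sum ?G k = row_sum F k" for k
  proof -
    consider "k = i" | "k = i'" | "k \<noteq> i" "k \<noteq> i'" by blast
    then show ?thesis
    proof cases
      case 1
      then have "{l. (k, l) \<in> ?G} = insert j' ({l. (k, l) \<in> F} - {j})"
        using ne by auto
      then show ?thesis using 1 swap[OF finite_row[OF fin]] in1 out1 by (simp add: row_sum_def)
    next
      case 2
      then have "{l. (k, l) \<in> ?G} = insert j ({l. (k, l) \<in> F} - {j'})"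
        using ne by auto
      then show ?thesis using 2 swap[OF finite_row[OF fin]] in2 out2 by (simp add: row_sum_def)
    next
      case 3
      then show ?thesis by (simp add: row_sum_def)
    qed
  qed
  have col: "col_sum ?G l = col_sum F l" for l
  proof -
    consider "l = j" | "l = j'" | "l \<noteq> j" "l \<noteq> j'" by blast
    then show ?thesis
    proof cases
      case 1
      then have "{k. (k, l) \<in> ?G} = insert i' ({k. (k, l) \<in> F} - {i})"
        using ne by auto
      then show ?thesis using 1 swap[OF finite_col[OF fin]] in1 out2 by (simp add: col_sum_def)
    next
      case 2
      then have "{k. (k, l) \<in> ?G} = insert i ({k. (k, l) \<in> F} - {i'})"
        using ne by auto
      then show ?thesis using 2 swap[OF finite_col[OF fin]] in2 out1 by (simp add: col_sum_def)
    next
      case 3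
      then show ?thesis by (simp add: col_sum_def)
    qed
  qed
  have "finite ?G" using fin by simp
  then have "\<forall>k. finite {l. (k, l) \<in> ?G} \<and> row_sum ?G k = row_sum F k"
    and "\<forall>l. finite {k. (k, l) \<in> ?G} \<and> col_sum ?G l = col_sum F l"
    using finite_row[of ?G] finite_col[of ?G] row col by blast+
  then have "?G = F" using ud unfolding uniquely_determined_def by blast
  then show False using out1 by blast
qed

text \<open>The sets \<open>N i\<close> are the rows (or the columns) of a set without switching component. The
  smallest of the rows with at least \<open>l\<close> points is contained in all of them.\<close>

lemma nested_card_superlevel:
  fixes N :: "'a \<Rightarrow> 'b set"
  assumes nested: "\<And>i i'. N i \<subseteq> N i' \<or> N i' \<subseteq> N i"
    and finN: "\<And>i. finite (N i)" and finM: "\<And>j. finite {i. j \<in> N i}"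
    and finC: "finite {j. k \<le> card {i. j \<in> N i}}"
    and k: "1 \<le> k" "k \<le> card {i. l \<le> card (N i)}"
  shows "l \<le> card {j. k \<le> card {i. j \<in> N i}}"
proof -
  let ?I = "{i. l \<le> card (N i)}"
  have "0 < card ?I" using k by simp
  \<comment> \<open>An infinite set has \<open>card\<close> 0, so a positive cardinality also gives
    finiteness, and a row of least size exists.\<close>
  then have "finite ?I" "?I \<noteq> {}" by (auto simp: card_gt_0_iff)
  then obtain i where i: "i \<in> ?I" and min: "\<forall>i'\<in>?I. card (N i) \<le> card (N i')"
    using ex_min_if_finite[of "(\<lambda>i. card (N i)) ` ?I"] by (auto simp: not_less)
  have sub: "N i \<subseteq> N i'" if "i' \<in> ?I" for i'
  proof (rule ccontr)
    assume "\<not> N i \<subseteq> N i'"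
    then have "N i' \<subset> N i" using nested[of i i'] by blast
    then have "card (N i') < card (N i)" by (rule psubset_card_mono[OF finN])
    then show False using min that by force
  qed
  have "N i \<subseteq> {j. k \<le> card {i. j \<in> N i}}"
  proof
    fix j assume "j \<in> N i"
    then have "?I \<subseteq> {i. j \<in> N i}" using sub by blast
    then have "card ?I \<le> card {i. j \<in> N i}" by (rule card_mono[OF finM])
    then show "j \<in> {j. k \<le> card {i. j \<in> N i}}" using k by simp
  qed
  from card_mono[OF finC this] show ?thesis using i by simp
qed

text \<open>Without switching components both the rows and the columns are chains under inclusion,
  so \<open>nested_card_superlevel\<close> applies in both directions.\<close>

lemma uniquely_determined_diagrams:
  assumes ud: "uniquely_determined F"
  shows "(diagram (col_sum F))\<inverse> = diagram (row_sum F)"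
proof -
  have fin: "finite F" using ud by (simp add: uniquely_determined_def)
  note no_switch = uniquely_determined_no_switch[OF ud]
  have rows: "{j. (i, j) \<in> F} \<subseteq> {j. (i', j) \<in> F} \<or> {j. (i', j) \<in> F} \<subseteq> {j. (i, j) \<in> F}" for i i'
    using no_switch by blast
  have cols: "{i. (i, j) \<in> F} \<subseteq> {i. (i, j') \<in> F} \<or> {i. (i, j') \<in> F} \<subseteq> {i. (i, j) \<in> F}" for j j'
    using no_switch by blast
  have "k \<le> card {i. l \<le> row_sum F i} \<longleftrightarrow> l \<le> card {j. k \<le> col_sum F j}"
    if "1 \<le> k" "1 \<le> l" for k l
  proof
    assume "k \<le> card {i. l \<le> row_sum F i}"
    then show "l \<le> card {j. k \<le> col_sum F j}"
      using nested_card_superlevel[of "\<lambda>i. {j. (i, j) \<in> F}" k l, OF rows]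
        finite_superlevel[OF finite_col_support[OF fin] that(1)]
        finite_row[OF fin] finite_col[OF fin] that
      by (simp add: row_sum_def col_sum_def)
  next
    assume "l \<le> card {j. k \<le> col_sum F j}"
    then show "k \<le> card {i. l \<le> row_sum F i}"
      using nested_card_superlevel[of "\<lambda>j. {i. (i, j) \<in> F}" l k, OF cols]
        finite_superlevel[OF finite_row_support[OF fin] that(2)]
        finite_row[OF fin] finite_col[OF fin] that
      by (simp add: row_sum_def col_sum_def)
  qed
  then show ?thesis by (auto simp: diagram_def)
qed

text \<open>Double counting: \<open>f i\<close> occurs once for each point of row \<open>i\<close>,
  and \<open>g j\<close> once for each point of column \<open>j\<close>.\<close>

lemma sum_row_col_weights:
  fixes f g :: "int \<Rightarrow> int"
  assumes fin: "finite F" and sub: "F \<subseteq> I \<times> J" and I: "finite I" and J: "finite J"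
  shows "(\<Sum>(i, j)\<in>F. f i + g j) =
    (\<Sum>i\<in>I. int (row_sum F i) * f i) + (\<Sum>j\<in>J. int (col_sum F j) * g j)"
proof -
  have row: "(\<Sum>(i, j)\<in>F. f i) = (\<Sum>i\<in>I. int (row_sum F i) * f i)"
  proof -
    have F: "F = Sigma I (\<lambda>i. {j. (i, j) \<in> F})" using sub by auto
    show ?thesis
      by (subst F, subst sum.Sigma[symmetric]) (use I finite_row[OF fin] in \<open>auto simp: row_sum_def\<close>)
  qed
  have col: "(\<Sum>(i, j)\<in>F. g j) = (\<Sum>j\<in>J. int (col_sum F j) * g j)"
  proof -
    have F: "F = prod.swap ` Sigma J (\<lambda>j. {i. (i, j) \<in> F})" using sub by force
    have "(\<Sum>(i, j)\<in>F. g j) = (\<Sum>(j, i)\<in>Sigma J (\<lambda>j. {i. (i, j) \<in> F}). g j)"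
      by (subst F, subst sum.reindex) (auto intro: inj_onI sum.cong)
    also have "\<dots> = (\<Sum>j\<in>J. int (col_sum F j) * g j)"
      by (subst sum.Sigma[symmetric]) (use J finite_col[OF fin] in \<open>auto simp: col_sum_def\<close>)
    finally show ?thesis .
  qed
  show ?thesis using row col by (simp add: case_prod_unfold sum.distrib)
qed

text \<open>An additive set: the sum of the weights \<open>f i + g j\<close> over a set depends only on its line
  sums, and \<open>F\<close> is the unique set that maximises it.\<close>

lemma additive_uniquely_determined:
  fixes f g :: "int \<Rightarrow> int"
  assumes fin: "finite F" and sub: "F \<subseteq> I \<times> J"
    and pos: "\<And>i j. (i, j) \<in> F \<Longrightarrow> 0 < f i + g j"
    and neg: "\<And>i j. i \<in> I \<Longrightarrow> j \<in> J \<Longrightarrow> (i, j) \<notin> F \<Longrightarrow> f i + g j < 0"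
    and rows: "\<And>i. i \<in> I \<Longrightarrow> row_sum F i \<noteq> 0" and cols: "\<And>j. j \<in> J \<Longrightarrow> col_sum F j \<noteq> 0"
  shows "uniquely_determined F"
  unfolding uniquely_determined_def
proof (intro conjI allI impI)
  show "finite F" by fact
next
  fix G
  assume "(\<forall>i. finite {j. (i, j) \<in> G} \<and> row_sum G i = row_sum F i) \<and>
    (\<forall>j. finite {i. (i, j) \<in> G} \<and> col_sum G j = col_sum F j)"
  then have G: "finite {j. (i, j) \<in> G}" "row_sum G i = row_sum F i"
    "finite {i. (i, j) \<in> G}" "col_sum G j = col_sum F j" for i j by blast+
  have I: "finite I"
    by (rule finite_subset[OF _ finite_row_support[OF fin]]) (use rows in auto)
  have J: "finite J"
    by (rule finite_subset[OF _ finite_col_support[OF fin]]) (use cols in auto)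
  \<comment> \<open>The lines of \<open>G\<close> are finite, so a point of \<open>G\<close> makes
    the line sums through it nonzero; then \<open>F\<close> has points on the same two lines, and
    these lie in the box.\<close>
  have subG: "G \<subseteq> I \<times> J"
  proof clarify
    fix i j assume ij: "(i, j) \<in> G"
    have "row_sum G i \<noteq> 0" "col_sum G j \<noteq> 0"
      using ij G(1)[of i] G(3)[of j] by (auto simp: row_sum_def col_sum_def)
    then have "row_sum F i \<noteq> 0" "col_sum F j \<noteq> 0" by (simp_all add: G)
    then obtain i' j' where "(i, j') \<in> F" "(i', j) \<in> F"
      unfolding row_sum_def col_sum_def by (metis (no_types, lifting) card.empty empty_Collect_eq)
    then show "i \<in> I \<and> j \<in> J" using sub by blast
  qed
  have finG: "finite G" by (rule finite_subset[OF subG]) (use I J in simp)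
  let ?w = "\<lambda>(i, j). f i + g j"
  have eq: "sum ?w F = sum ?w G"
    unfolding sum_row_col_weights[OF fin sub I J] sum_row_col_weights[OF finG subG I J]
    by (simp add: G)
  have "sum ?w F = sum ?w (F \<inter> G) + sum ?w (F - G)"
    using sum.Int_Diff[OF fin] .
  moreover have "sum ?w G = sum ?w (F \<inter> G) + sum ?w (G - F)"
    using sum.Int_Diff[OF finG, of ?w F] by (simp add: Int_commute)
  \<comment> \<open>The common part cancels. What remains is nonnegative on the left and nonpositive
    on the right, hence 0; the strict signs then leave no points.\<close>
  ultimately have eq': "sum ?w (F - G) = sum ?w (G - F)" using eq by simp
  have "0 \<le> sum ?w (F - G)" by (rule sum_nonneg) (use pos in force)
  moreover have "sum ?w (G - F) \<le> 0" by (rule sum_nonpos) (use neg subG in force)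
  ultimately have z: "sum ?w (F - G) = 0" "sum ?w (G - F) = 0" using eq' by simp_all
  have "F - G = {}"
  proof (rule ccontr)
    assume "F - G \<noteq> {}"
    then have "0 < sum ?w (F - G)" using fin pos by (intro sum_pos) auto
    then show False using z by simp
  qed
  moreover have "G - F = {}"
  proof (rule ccontr)
    assume "G - F \<noteq> {}"
    then have "0 < sum (\<lambda>p. - ?w p) (G - F)" using finG neg subG by (intro sum_pos) force+
    then show False using z by (simp add: sum_negf)
  qed
  ultimately show "G = F" by blast
qed

section \<open>Young diagrams as point sets in the plane\<close>

definition young :: "(int \<Rightarrow> nat) \<Rightarrow> (int \<times> int) set" where
  "young f = {(i, j). 1 \<le> i \<and> 1 \<le> j \<and> j \<le> int (f i)}"

lemma row_sum_young:
  assumes "decreasing f"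
  shows "row_sum (young f) = f"
proof
  fix i
  show "row_sum (young f) i = f i"
  proof (cases "1 \<le> i")
    case True
    then have "{j. (i, j) \<in> young f} = {1..int (f i)}" by (auto simp: young_def)
    then show ?thesis by (simp add: row_sum_def)
  next
    case False
    then show ?thesis using assms by (auto simp: row_sum_def young_def decreasing_def)
  qed
qed

lemma finite_young:
  assumes "finite {i. f i \<noteq> 0}"
  shows "finite (young f)"
proof (rule finite_subset)
  show "young f \<subseteq> Sigma {i. f i \<noteq> 0} (\<lambda>i. {1..int (f i)})" by (auto simp: young_def)
qed (use assms in auto)

text \<open>Every row is left-justified, so a column of positive index contains all later
  ones.\<close>

lemma col_sum_young_decreasing:
  assumes fin: "finite {i. f i \<noteq> 0}"
  shows "decreasing (col_sum (young f))"
  unfolding decreasing_def monotone_on_def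
proof (intro conjI allI impI ballI)
  fix j :: int assume "j \<le> 0"
  then show "col_sum (young f) j = 0" by (auto simp: col_sum_def young_def)
next
  fix j j' :: int assume "j \<in> {1..}" "j' \<in> {1..}" "j \<le> j'"
  then show "col_sum (young f) j' \<le> col_sum (young f) j"
    unfolding col_sum_def
    by (intro card_mono finite_col finite_young fin) (auto simp: young_def)
qed

text \<open>The weight of a cell of the diagram is its hook length, hence positive; the same
  expression is negative outside the diagram.\<close>

lemma young_uniquely_determined:
  assumes fin: "finite {i. f i \<noteq> 0}" and dec: "decreasing f"
  shows "uniquely_determined (young f)"
proof -
  let ?Y = "young f"
  have finY: "finite ?Y" by (rule finite_young[OF fin])
  have mem_row: "(i, j) \<in> ?Y \<longleftrightarrow> 1 \<le> i \<and> 1 \<le> j \<and> j \<le> int (row_sum ?Y i)" for i j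
    unfolding row_sum_young[OF dec] by (simp add: young_def)
  \<comment> \<open>The dual description by column lengths: a column of positive index is a
    superlevel set of \<open>f\<close>, hence an initial segment.\<close>
  have mem_col: "(i, j) \<in> ?Y \<longleftrightarrow> 1 \<le> i \<and> 1 \<le> j \<and> i \<le> int (col_sum ?Y j)" for i j
  proof (cases "1 \<le> i \<and> 1 \<le> j")
    case True
    then obtain k l where kl: "i = int k" "j = int l" "1 \<le> k" "1 \<le> l"
      by (intro that[of "nat i" "nat j"]) auto
    have "{i. (i, j) \<in> ?Y} = {i. l \<le> f i}"
    proof (rule set_eqI)
      fix i
      have "f i = 0" if "\<not> 1 \<le> i" using that dec by (simp add: decreasing_def)
      then show "i \<in> {i. (i, j) \<in> ?Y} \<longleftrightarrow> i \<in> {i. l \<le> f i}"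
        using kl by (cases "1 \<le> i") (auto simp: young_def)
    qed
    then have "col_sum ?Y j = card {i. l \<le> f i}" by (simp add: col_sum_def)
    then show ?thesis
      using decreasing_card_le_iff[OF fin dec kl(3,4)] True kl by (simp add: young_def)
  next
    case False
    then show ?thesis by (auto simp: young_def)
  qed
  show ?thesis
  proof (rule additive_uniquely_determined[where
        f = "\<lambda>i. int (row_sum ?Y i) - i" and g = "\<lambda>j. int (col_sum ?Y j) - j + 1"
        and I = "{i. 1 \<le> i \<and> row_sum ?Y i \<noteq> 0}" and J = "{j. 1 \<le> j \<and> col_sum ?Y j \<noteq> 0}"])
    show "?Y \<subseteq> {i. 1 \<le> i \<and> row_sum ?Y i \<noteq> 0} \<times> {j. 1 \<le> j \<and> col_sum ?Y j \<noteq> 0}"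
    proof (rule subrelI)
      fix i j assume *: "(i, j) \<in> ?Y"
      show "(i, j) \<in> {i. 1 \<le> i \<and> row_sum ?Y i \<noteq> 0} \<times> {j. 1 \<le> j \<and> col_sum ?Y j \<noteq> 0}"
        using *[unfolded mem_row] *[unfolded mem_col] by auto
    qed
  next
    fix i j assume *: "(i, j) \<in> ?Y"
    show "0 < int (row_sum ?Y i) - i + (int (col_sum ?Y j) - j + 1)"
      using *[unfolded mem_row] *[unfolded mem_col] by linarith
  next
    fix i j
    assume "i \<in> {i. 1 \<le> i \<and> row_sum ?Y i \<noteq> 0}" "j \<in> {j. 1 \<le> j \<and> col_sum ?Y j \<noteq> 0}"
      and *: "(i, j) \<notin> ?Y"
    \<comment> \<open>Here \<open>int (row_sum ?Y i) - j\<close> and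
      \<open>int (col_sum ?Y j) - i\<close> are at most -1, against at least 0 inside the diagram.
      The added 1 keeps the weight off 0 in both cases.\<close>
    then show "int (row_sum ?Y i) - i + (int (col_sum ?Y j) - j + 1) < 0"
      using *[unfolded mem_row] *[unfolded mem_col] by simp
  qed (use finY in auto)
qed

subsection \<open>The minimal distance\<close>

text \<open>The lower bound is the triangle inequality through the diagram of the competitor. It is
  attained by \<open>young (row_sum F)\<close>: the row sums agree with those of \<open>F\<close>,
  so only the column part of \<open>alpha\<close> remains.\<close>

lemma alpha0_eq:
  assumes F: "finite F" "decreasing (row_sum F)" "decreasing (col_sum F)"
  shows "alpha0 F =
    1 / 2 * real (card {p. (p \<in> diagram (row_sum F)) \<noteq> (p \<in> (diagram (col_sum F))\<inverse>)})"
proof -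
  let ?X = "diagram (row_sum F)" and ?Y = "(diagram (col_sum F))\<inverse>"
  have finX: "finite ?X" and finY: "finite ?Y"
    using finite_diagram finite_row_support[OF F(1)] finite_col_support[OF F(1)] by simp_all
  let ?G = "young (row_sum F)"
  have udG: "uniquely_determined ?G"
    by (rule young_uniquely_determined[OF finite_row_support[OF F(1)] F(2)])
  have rowG: "row_sum ?G = row_sum F" by (rule row_sum_young[OF F(2)])
  have colG: "(diagram (col_sum ?G))\<inverse> = ?X"
    using uniquely_determined_diagrams[OF udG] by (simp add: rowG)
  have "alpha F ?G = 1 / 2 * real (card {p. (p \<in> ?Y) \<noteq> (p \<in> ?X)})"
    using alpha_eq_card_diagram_differ[OF F, of ?G] F(2) colG rowG
      finite_young[OF finite_row_support[OF F(1)]]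
      col_sum_young_decreasing[OF finite_row_support[OF F(1)]]
    by simp
  also have "{p. (p \<in> ?Y) \<noteq> (p \<in> ?X)} = {p. (p \<in> ?X) \<noteq> (p \<in> ?Y)}" by auto
  finally have attained: "1 / 2 * real (card {p. (p \<in> ?X) \<noteq> (p \<in> ?Y)}) = alpha F ?G" ..
  show ?thesis
    unfolding alpha0_def
  proof (rule Least_equality)
    show "1 / 2 * real (card {p. (p \<in> ?X) \<noteq> (p \<in> ?Y)}) \<in> {alpha F G |G. uniquely_determined G}"
      using attained udG by blast
  next
    fix x assume "x \<in> {alpha F G |G. uniquely_determined G}"
    then obtain G where x: "x = alpha F G" and udG: "uniquely_determined G" by blast
    have finG: "finite G" using udG by (simp add: uniquely_determined_def)
    let ?D = "diagram (row_sum G)"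
    have finD: "finite ?D" by (rule finite_diagram[OF finite_row_support[OF finG]])
    have "card {p. (p \<in> ?X) \<noteq> (p \<in> ?Y)} \<le>
        card {p. (p \<in> ?Y) \<noteq> (p \<in> ?D)} + card {p. (p \<in> ?X) \<noteq> (p \<in> ?D)}"
      using card_differ_sum[OF finX finY finD] by linarith
    then have "1 / 2 * real (card {p. (p \<in> ?X) \<noteq> (p \<in> ?Y)}) \<le>
        1 / 2 * real (card {p. (p \<in> ?Y) \<noteq> (p \<in> ?D)} + card {p. (p \<in> ?X) \<noteq> (p \<in> ?D)})"
      by (intro mult_left_mono) simp_all
    also have "\<dots> \<le> x"
      using alpha_ge_card_diagram_differ[OF F(1) finG]
      unfolding x uniquely_determined_diagrams[OF udG] .
    finally show "1 / 2 * real (card {p. (p \<in> ?X) \<noteq> (p \<in> ?Y)}) \<le> x" .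
  qed
qed

text \<open>The excess of \<open>alpha F G\<close> over the minimum is exactly the number of cells
  in \<open>?Z\<close>, the defect from \<open>card_differ_sum\<close>; the factor 2 there cancels
  the 1/2 in \<open>alpha\<close>.\<close>

lemma alpha_eq_alpha0_iff:
  assumes F: "finite F" "decreasing (row_sum F)" "decreasing (col_sum F)"
    and G: "uniquely_determined G" "decreasing (row_sum G)" "decreasing (col_sum G)"
  shows "alpha F G = alpha0 F \<longleftrightarrow>
    diagram (row_sum F) \<inter> (diagram (col_sum F))\<inverse> \<subseteq> diagram (row_sum G) \<and>
    diagram (row_sum G) \<subseteq> diagram (row_sum F) \<union> (diagram (col_sum F))\<inverse>"
proof -
  let ?X = "diagram (row_sum F)" and ?Y = "(diagram (col_sum F))\<inverse>" and ?D = "diagram (row_sum G)"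
  let ?Z = "(?X \<inter> ?Y - ?D) \<union> (?D - (?X \<union> ?Y))"
  have finG: "finite G" using G by (simp add: uniquely_determined_def)
  have fin: "finite ?X" "finite ?Y" "finite ?D"
    using finite_diagram finite_row_support[OF F(1)] finite_col_support[OF F(1)]
      finite_row_support[OF finG] by simp_all
  have "alpha F G =
      1 / 2 * real (card {p. (p \<in> ?Y) \<noteq> (p \<in> ?D)} + card {p. (p \<in> ?X) \<noteq> (p \<in> ?D)})"
    using alpha_eq_card_diagram_differ[OF F finG G(2,3)]
    unfolding uniquely_determined_diagrams[OF G(1)] .
  then have "alpha F G = alpha0 F + real (card ?Z)"
    unfolding alpha0_eq[OF F] card_differ_sum[OF fin] by simp
  then have "alpha F G = alpha0 F \<longleftrightarrow> card ?Z = 0" by simp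
  also have "\<dots> \<longleftrightarrow> ?Z = {}" using fin by simp
  finally show ?thesis by blast
qed

section \<open>From inclusions of diagrams to inequalities for lengths\<close>

lemma between_iff_thresholds:
  fixes x y d :: nat
  shows "min x y \<le> d \<and> d \<le> max x y \<longleftrightarrow>
    (\<forall>l\<ge>1. (l \<le> x \<and> l \<le> y \<longrightarrow> l \<le> d) \<and> (l \<le> d \<longrightarrow> l \<le> x \<or> l \<le> y))" (is "_ \<longleftrightarrow> ?R")
proof
  assume ?R
  \<comment> \<open>The critical thresholds are \<open>min x y\<close> and \<open>d\<close>; the
    value 0 is treated apart because thresholds start at 1.\<close>
  have "min x y \<le> d"
    using \<open>?R\<close>[rule_format, of "min x y"] by (cases "min x y = 0") auto
  moreover have "d \<le> max x y"
    using \<open>?R\<close>[rule_format, of d] by (cases "d = 0") auto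
  ultimately show "min x y \<le> d \<and> d \<le> max x y" by simp
qed auto

text \<open>For fixed \<open>k\<close> the inclusions compare thresholds, as in
  \<open>between_iff_thresholds\<close>. Since \<open>k\<close> may index rows or columns, this
  serves both (ii) and (iii).\<close>

lemma diagram_between_iff:
  assumes X: "\<And>k l. (k, l) \<in> X \<longleftrightarrow> 1 \<le> k \<and> 1 \<le> l \<and> l \<le> x k"
    and Y: "\<And>k l. (k, l) \<in> Y \<longleftrightarrow> 1 \<le> k \<and> 1 \<le> l \<and> l \<le> y k"
    and D: "\<And>k l. (k, l) \<in> D \<longleftrightarrow> 1 \<le> k \<and> 1 \<le> l \<and> l \<le> d k"
  shows "X \<inter> Y \<subseteq> D \<and> D \<subseteq> X \<union> Y \<longleftrightarrow>
    (\<forall>k\<ge>1::nat. min (x k) (y k) \<le> d k \<and> d k \<le> max (x k) (y k :: nat))"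
  unfolding between_iff_thresholds subset_iff split_paired_All Int_iff Un_iff X Y D by blast

section \<open>Sortedness of the given line sums\<close>

lemma decreasing_of_support:
  fixes f :: "int \<Rightarrow> nat"
  assumes zero: "\<And>i. i \<notin> {1..int m} \<Longrightarrow> f i = 0"
    and x: "\<forall>i\<in>{1..m}. x i = f (int i)"
    and dec: "\<forall>i\<in>{1..m}. \<forall>i'\<in>{1..m}. i \<le> i' \<longrightarrow> x i' \<le> x i"
  shows "decreasing f"
  unfolding decreasing_def monotone_on_def
proof (intro conjI allI impI ballI)
  fix i i' :: int assume *: "i \<in> {1..}" "i' \<in> {1..}" "i \<le> i'"
  show "f i' \<le> f i"
  proof (cases "i' \<le> int m")
    case True
    then have "nat i \<in> {1..m}" "nat i' \<in> {1..m}" "nat i \<le> nat i'" using * by auto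
    then have "x (nat i') \<le> x (nat i)" "x (nat i') = f (int (nat i'))" "x (nat i) = f (int (nat i))"
      using dec x by blast+
    moreover have "int (nat i') = i'" "int (nat i) = i" using * by simp_all
    ultimately show ?thesis by simp
  qed (use zero in simp)
qed (use zero in simp)

lemma decreasing_of_Suc:
  fixes f :: "int \<Rightarrow> nat"
  assumes zero: "\<forall>i\<le>0. f i = 0"
    and x: "\<forall>i\<ge>1. x i = f (int i)"
    and dec: "\<forall>i\<ge>1. x (Suc i) \<le> x i"
  shows "decreasing f"
  unfolding decreasing_def monotone_on_def
proof (intro conjI ballI impI)
  fix i i' :: int assume *: "i \<in> {1..}" "i' \<in> {1..}" "i \<le> i'"
  have "nat i \<le> nat i'" using * by simp
  then have "x (nat i') \<le> x (nat i)"
  proof (induction rule: dec_induct)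
    case (step k)
    then have "1 \<le> k" using * by simp
    then show ?case using dec step.IH by (meson order_trans)
  qed simp
  then show "f i' \<le> f i" using x * by (simp add: le_nat_iff)
qed (use zero in simp)


theorem theorem1:
  fixes F\<^sub>1 F\<^sub>2 :: "(int \<times> int) set"
    and m n :: nat
    and r c a b u v :: "nat \<Rightarrow> nat"
  assumes "finite F\<^sub>2"
    and "F\<^sub>2 \<subseteq> {1..int m} \<times> {1..int n}"
    and "\<forall>i\<in>{1..m}. r i = row_sum F\<^sub>2 (int i) \<and> r i \<noteq> 0"
    and "\<forall>j\<in>{1..n}. c j = col_sum F\<^sub>2 (int j) \<and> c j \<noteq> 0"
    and "\<forall>i\<in>{1..m}. \<forall>i'\<in>{1..m}. i \<le> i' \<longrightarrow> r i' \<le> r i"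
    and "\<forall>j\<in>{1..n}. \<forall>j'\<in>{1..n}. j \<le> j' \<longrightarrow> c j' \<le> c j"
    and "\<forall>j\<in>{1..n}. a j = card {i \<in> {1..m}. j \<le> r i}"
    and "\<forall>i\<in>{1..m}. b i = card {j \<in> {1..n}. i \<le> c j}"
    and "uniquely_determined F\<^sub>1"
    and "\<forall>i\<ge>1. u i = row_sum F\<^sub>1 (int i)"
    and "\<forall>j\<ge>1. v j = col_sum F\<^sub>1 (int j)"
    and "\<forall>i\<ge>1. u (Suc i) \<le> u i"
    and "\<forall>j\<ge>1. v (Suc j) \<le> v j"
    and "\<forall>i\<le>0. row_sum F\<^sub>1 i = 0"
    and "\<forall>j\<le>0. col_sum F\<^sub>1 j = 0"
  shows "(alpha F\<^sub>2 F\<^sub>1 = alpha0 F\<^sub>2 \<longleftrightarrow>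
            (\<forall>j\<ge>1. if j \<le> n then min (a j) (c j) \<le> v j \<and> v j \<le> max (a j) (c j) else v j = 0))
       \<and> (alpha F\<^sub>2 F\<^sub>1 = alpha0 F\<^sub>2 \<longleftrightarrow>
            (\<forall>i\<ge>1. if i \<le> m then min (b i) (r i) \<le> u i \<and> u i \<le> max (b i) (r i) else u i = 0))"
proof -
  note F2 = assms(1)
  have row0: "row_sum F\<^sub>2 i = 0" if "i \<notin> {1..int m}" for i
    using that assms(2) by (auto simp: row_sum_def card_eq_0_iff)
  have col0: "col_sum F\<^sub>2 j = 0" if "j \<notin> {1..int n}" for j
    using that assms(2) by (auto simp: col_sum_def card_eq_0_iff)
  have dec2: "decreasing (row_sum F\<^sub>2)" "decreasing (col_sum F\<^sub>2)"
    using decreasing_of_support[of m "row_sum F\<^sub>2" r, OF row0] decreasing_of_support[of n "col_sum F\<^sub>2" c, OF col0]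
      assms(3-6) by auto
  have dec1: "decreasing (row_sum F\<^sub>1)" "decreasing (col_sum F\<^sub>1)"
    using decreasing_of_Suc assms(10-15) by blast+
  have fin1: "finite F\<^sub>1" using assms(9) by (simp add: uniquely_determined_def)
  let ?X = "diagram (row_sum F\<^sub>2)" and ?Y = "(diagram (col_sum F\<^sub>2))\<inverse>" and ?D = "diagram (row_sum F\<^sub>1)"
  let ?a = "\<lambda>j. card {i. j \<le> row_sum F\<^sub>2 i}" and ?b = "\<lambda>i. card {j. i \<le> col_sum F\<^sub>2 j}"
  let ?r = "\<lambda>i. row_sum F\<^sub>2 (int i)" and ?c = "\<lambda>j. col_sum F\<^sub>2 (int j)"
  \<comment> \<open>The counts in the hypotheses run over \<open>{1..m}\<close> or
    \<open>{1..n}\<close>, those in the diagrams over all integers; at positive levels they agree,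
    since the lines outside the range are empty.\<close>
  have count: "card {i \<in> {1..m}. l \<le> x i} = card {i. l \<le> f i}"
    if "1 \<le> l" and zero: "\<And>i. i \<notin> {1..int m} \<Longrightarrow> f i = 0" and x: "\<forall>i\<in>{1..m}. x i = f (int i)"
    for l m :: nat and x f
  proof -
    have "{i. l \<le> f i} = int ` {i \<in> {1..m}. l \<le> x i}"
    proof (rule set_eqI)
      fix i
      show "i \<in> {i. l \<le> f i} \<longleftrightarrow> i \<in> int ` {i \<in> {1..m}. l \<le> x i}"
      proof
        assume i: "i \<in> {i. l \<le> f i}"
        then have "i \<in> {1..int m}" using zero[of i] \<open>1 \<le> l\<close> by fastforce
        then obtain k where k: "i = int k" "k \<in> {1..m}"
          by (intro that[of "nat i"]) auto
        then show "i \<in> int ` {i \<in> {1..m}. l \<le> x i}" using i x by auto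
      qed (use x in auto)
    qed
    then show ?thesis by (simp add: card_image)
  qed
  have a: "a j = ?a j" if "j \<in> {1..n}" for j
    using assms(7) that count[of j m "row_sum F\<^sub>2" r, OF _ row0] assms(3) by auto
  have b: "b i = ?b i" if "i \<in> {1..m}" for i
    using assms(8) that count[of i n "col_sum F\<^sub>2" c, OF _ col0] assms(4) by auto
  \<comment> \<open>No row has more than \<open>n\<close> points. Beyond \<open>n\<close> the column
    sum is 0 too, so the two bounds collapse and force \<open>v j = 0\<close>; \<open>b0\<close>
    does the same for rows.\<close>
  have a0: "?a j = 0" if "n < j" for j
  proof -
    have "row_sum F\<^sub>2 i \<le> n" for i
    proof -
      have "row_sum F\<^sub>2 i \<le> card {1..int n}"
        unfolding row_sum_def by (rule card_mono) (use assms(2) in auto)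
      then show ?thesis by simp
    qed
    then have "{i. j \<le> row_sum F\<^sub>2 i} = {}" using that by (auto simp: not_le intro: le_less_trans)
    then show ?thesis by simp
  qed
  have b0: "?b i = 0" if "m < i" for i
  proof -
    have "col_sum F\<^sub>2 j \<le> m" for j
    proof -
      have "col_sum F\<^sub>2 j \<le> card {1..int m}"
        unfolding col_sum_def by (rule card_mono) (use assms(2) in auto)
      then show ?thesis by simp
    qed
    then have "{j. i \<le> col_sum F\<^sub>2 j} = {}" using that by (auto simp: not_le intro: le_less_trans)
    then show ?thesis by simp
  qed
  note mem = mem_diagram_decreasing_iff[OF finite_row_support[OF F2] dec2(1)]
    mem_diagram_decreasing_iff[OF finite_col_support[OF F2] dec2(2)]
    mem_diagram_decreasing_iff[OF finite_row_support[OF fin1] dec1(1)]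
    mem_diagram_decreasing_iff[OF finite_col_support[OF fin1] dec1(2)]
  have main: "alpha F\<^sub>2 F\<^sub>1 = alpha0 F\<^sub>2 \<longleftrightarrow> ?X \<inter> ?Y \<subseteq> ?D \<and> ?D \<subseteq> ?X \<union> ?Y"
    by (rule alpha_eq_alpha0_iff[OF F2 dec2 assms(9) dec1])
  also have "\<dots> \<longleftrightarrow> (\<forall>i\<ge>1. min (?r i) (?b i) \<le> u i \<and> u i \<le> max (?r i) (?b i))"
  proof (rule diagram_between_iff)
    fix k l
    show "(k, l) \<in> ?X \<longleftrightarrow> 1 \<le> k \<and> 1 \<le> l \<and> l \<le> ?r k" by (rule mem(1))
    \<comment> \<open>Transposition turns the counts \<open>?b\<close> into row lengths by the
      definition of \<open>diagram\<close>, while the row lengths \<open>?r\<close> rest on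
      sortedness.\<close>
    show "(k, l) \<in> ?Y \<longleftrightarrow> 1 \<le> k \<and> 1 \<le> l \<and> l \<le> ?b k" by (auto simp: diagram_def)
    show "(k, l) \<in> ?D \<longleftrightarrow> 1 \<le> k \<and> 1 \<le> l \<and> l \<le> u k" using mem(3) assms(10) by auto
  qed
  also have "\<dots> \<longleftrightarrow>
      (\<forall>i\<ge>1. if i \<le> m then min (b i) (r i) \<le> u i \<and> u i \<le> max (b i) (r i) else u i = 0)"
  proof (intro all_cong)
    fix i :: nat assume i: "1 \<le> i"
    show "(min (?r i) (?b i) \<le> u i \<and> u i \<le> max (?r i) (?b i)) \<longleftrightarrow>
        (if i \<le> m then min (b i) (r i) \<le> u i \<and> u i \<le> max (b i) (r i) else u i = 0)"
    proof (cases "i \<le> m")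
      case True
      then have "r i = ?r i" "b i = ?b i" using i assms(3) b by auto
      then show ?thesis using True by (simp add: min.commute max.commute)
    next
      case False
      then show ?thesis using row0[of "int i"] b0[of i] by simp
    qed
  qed
  finally have iii: "alpha F\<^sub>2 F\<^sub>1 = alpha0 F\<^sub>2 \<longleftrightarrow>
      (\<forall>i\<ge>1. if i \<le> m then min (b i) (r i) \<le> u i \<and> u i \<le> max (b i) (r i) else u i = 0)" .
  have D: "?D = (diagram (col_sum F\<^sub>1))\<inverse>"
    by (rule uniquely_determined_diagrams[OF assms(9), symmetric])
  note main
  \<comment> \<open>Transposing all diagrams makes the columns the first coordinate, so the same
    criterion now gives (ii).\<close>
  also have "?X \<inter> ?Y \<subseteq> ?D \<and> ?D \<subseteq> ?X \<union> ?Y \<longleftrightarrow>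
      ?X\<inverse> \<inter> ?Y\<inverse> \<subseteq> ?D\<inverse> \<and> ?D\<inverse> \<subseteq> ?X\<inverse> \<union> ?Y\<inverse>"
    unfolding converse_Int[symmetric] converse_Un[symmetric] converse_mono ..
  also have "\<dots> \<longleftrightarrow> (\<forall>j\<ge>1. min (?a j) (?c j) \<le> v j \<and> v j \<le> max (?a j) (?c j))"
  proof (rule diagram_between_iff)
    fix k l
    show "(k, l) \<in> ?X\<inverse> \<longleftrightarrow> 1 \<le> k \<and> 1 \<le> l \<and> l \<le> ?a k" by (auto simp: diagram_def)
    show "(k, l) \<in> ?Y\<inverse> \<longleftrightarrow> 1 \<le> k \<and> 1 \<le> l \<and> l \<le> ?c k" using mem(2) by simp
    show "(k, l) \<in> ?D\<inverse> \<longleftrightarrow> 1 \<le> k \<and> 1 \<le> l \<and> l \<le> v k"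
      unfolding D using mem(4) assms(11) by auto
  qed
  also have "\<dots> \<longleftrightarrow>
      (\<forall>j\<ge>1. if j \<le> n then min (a j) (c j) \<le> v j \<and> v j \<le> max (a j) (c j) else v j = 0)"
  proof (intro all_cong)
    fix j :: nat assume j: "1 \<le> j"
    show "(min (?a j) (?c j) \<le> v j \<and> v j \<le> max (?a j) (?c j)) \<longleftrightarrow>
        (if j \<le> n then min (a j) (c j) \<le> v j \<and> v j \<le> max (a j) (c j) else v j = 0)"
    proof (cases "j \<le> n")
      case True
      then have "c j = ?c j" "a j = ?a j" using j assms(4) a by auto
      then show ?thesis using True by simp
    next
      case False
      then show ?thesis using col0[of "int j"] a0[of j] by simp
    qed
  qed
  finally show ?thesis using iii by blast
qed

end
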